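(* Let $N\ge 0$ be an integer and let $a,b$ be integers with $a+b=N-1$. Let $\lambda,\mu\in\mathcal{P}_N$. Define $\ell,m\in\mathbb{Z}^N$ by $\ell_i:=\lambda_i-i$ and $m_i:=\mu_i-i$ for each $i\in[N]$. Then \[ \nabla\left(s_{\lambda/\mu}\right)=\sum_{\substack{i\in[N];\\ \lambda-e_i\in\mathcal{P}_N}}(\ell_i+a)\,s_{(\lambda-e_i)/\mu}+\sum_{\substack{i\in[N];\\ \mu+e_i\in\mathcal{P}_N}}(b-m_i)\,s_{\lambda/(\mu+e_i)}. \]
   Context: $R=\mathbb{Z}[x_1,\dots,x_N]$, and $\nabla:R\to R$ is the derivation $\nabla=\frac{\partial}{\partial x_1}+\cdots+\frac{\partial}{\partial x_N}$. $[N]=\{1,\dots,N\}$. For $i\in[N]$, $e_i\in\mathbb{Z}^N$ is the $i$-th standard basis vector; $N$-tuples are added and subtracted entrywise, and $a_i$ denotes the $i$-th entry of $a\in\mathbb{Z}^N$. $\mathcal{P}_N$ is the set of $a\in\mathbb{Z}^N$ with $a_1\ge a_2\ge\cdots\ge a_N\ge 0$. For $n\in\mathbb{Z}$, $h_n=\sum x_1^{i_1}\cdots x_N^{i_N}$ over all $(i_1,\dots,i_N)\in\mathbb{N}^N$ with $i_1+\cdots+i_N=n$ (so $h_0=1$, $h_n=0$ for $n<0$). For $\lambda,\mu\in\mathcal{P}_N$, $s_{\lambda/\mu}$ is the skew Schur polynomial in $x_1,\dots,x_N$ (defined to be $0$ unless $\mu_i\le\lambda_i$ for all $i$); equivalently,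 by the Jacobi–Trudi formula, $s_{\lambda/\mu}=\det\left(h_{\lambda_i-\mu_j-i+j}\right)_{i,j\in[N]}$. *)

theory Defs
  imports Main "HOL-Library.FuncSet" "HOL-Library.Function_Algebras" "HOL-Library.Poly_Mapping"
begin

(* A monomial is a finitely supported exponent vector. The variables are indexed by nat, and
   Z[x_1,...,x_N] sits inside this ring as the polynomials in the variables 1, ..., N only. *)
type_synonym mpoly_int = "(nat \<Rightarrow>\<^sub>0 nat) \<Rightarrow>\<^sub>0 int"

definition X :: "nat \<Rightarrow> mpoly_int" where
  "X i = Poly_Mapping.single (Poly_Mapping.single i 1) 1"

(* The exponent subtraction truncates only where the coefficient factor is 0. *)
definition partial_deriv :: "nat \<Rightarrow> mpoly_int \<Rightarrow> mpoly_int" where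
  "partial_deriv i p =
    (\<Sum>m\<in>Poly_Mapping.keys p.
      Poly_Mapping.single (m - Poly_Mapping.single i 1)
        (int (Poly_Mapping.lookup m i) * Poly_Mapping.lookup p m))"

definition nabla :: "nat \<Rightarrow> mpoly_int \<Rightarrow> mpoly_int" where
  "nabla N p = (\<Sum>i\<in>{1..N}. partial_deriv i p)"

(* An N-tuple of integers is a function vanishing outside {1..N}; addition and subtraction
   are the pointwise operations on functions. *)
definition int_tuples :: "nat \<Rightarrow> (nat \<Rightarrow> int) set" where
  "int_tuples N = {a. \<forall>i. i \<notin> {1..N} \<longrightarrow> a i = 0}"

definition unit_tuple :: "nat \<Rightarrow> nat \<Rightarrow> int" where
  "unit_tuple i = (\<lambda>k. if k = i then 1 else 0)"

definition partitions :: "nat \<Rightarrow> (nat \<Rightarrow> int) set" where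
  "partitions N = {a \<in> int_tuples N.
     (\<forall>i\<in>{1..N}. \<forall>j\<in>{1..N}. i \<le> j \<longrightarrow> a j \<le> a i) \<and> (\<forall>i\<in>{1..N}. 0 \<le> a i)}"

(* Cells (row, column) of the skew Young diagram, in English notation. *)
definition skew_diagram :: "nat \<Rightarrow> (nat \<Rightarrow> int) \<Rightarrow> (nat \<Rightarrow> int) \<Rightarrow> (nat \<times> int) set" where
  "skew_diagram N la mu = {(i, j). i \<in> {1..N} \<and> mu i < j \<and> j \<le> la i}"

definition semistandard_tableaux ::
    "nat \<Rightarrow> (nat \<Rightarrow> int) \<Rightarrow> (nat \<Rightarrow> int) \<Rightarrow> (nat \<times> int \<Rightarrow> nat) set" where
  "semistandard_tableaux N la mu =
    {T \<in> skew_diagram N la mu \<rightarrow>\<^sub>E {1..N}.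
      (\<forall>i j j'. (i, j) \<in> skew_diagram N la mu \<and> (i, j') \<in> skew_diagram N la mu \<and> j < j'
         \<longrightarrow> T (i, j) \<le> T (i, j')) \<and>
      (\<forall>i i' j. (i, j) \<in> skew_diagram N la mu \<and> (i', j) \<in> skew_diagram N la mu \<and> i < i'
         \<longrightarrow> T (i, j) < T (i', j))}"

definition skew_schur :: "nat \<Rightarrow> (nat \<Rightarrow> int) \<Rightarrow> (nat \<Rightarrow> int) \<Rightarrow> mpoly_int" where
  "skew_schur N la mu =
    (if \<forall>i\<in>{1..N}. mu i \<le> la i
     then \<Sum>T\<in>semistandard_tableaux N la mu. \<Prod>c\<in>skew_diagram N la mu. X (T c)
     else 0)"

end

theory Submission imports Defs begin

text \<open>
  Fix the number \<open>N\<close> of rows and let the number \<open>n\<close> of variables vary. For a scalar \<open>a\<close> let \<open>A\<^sub>a\<close> be the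
  matrix indexed by partitions with entry \<open>\<lambda>\<^sub>i - i + a\<close> at \<open>(\<lambda>, \<lambda> - e\<^sub>i)\<close>, and let \<open>S\<^sub>n\<close> be the matrix
  of the skew Schur polynomials in \<open>x\<^sub>1, \<dots>, x\<^sub>n\<close>. The theorem is the case \<open>n = N\<close> of
  \<open>\<nabla> S\<^sub>n = A\<^sub>a S\<^sub>n - S\<^sub>n A\<^bsub>a - n\<^esub>\<close>. Removing the cells with entry \<open>n + 1\<close> from a tableau factors \<open>S\<^bsub>n + 1\<^esub>\<close>
  through \<open>S\<^sub>n\<close> and the one-variable matrix of horizontal strips, and the identity is inherited by
  such products, because \<open>\<nabla>\<close> is a derivation and the middle terms cancel. So only \<open>n = 0\<close> and
  one variable have to be checked; in the latter case, when \<open>\<lambda>/\<mu>\<close> is not a horizontal strip,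
  lowering \<open>\<lambda>\<^bsub>j + 1\<^esub>\<close> yields one exactly when raising \<open>\<mu>\<^sub>j\<close> does, with equal coefficients.
\<close>

section \<open>Partitions, horizontal strips, and the effect of moving one cell\<close>

abbreviation (input) down_rows :: "nat \<Rightarrow> (nat \<Rightarrow> int) \<Rightarrow> nat set" where
  "down_rows N la \<equiv> {i \<in> {1..N}. la - unit_tuple i \<in> partitions N}"

abbreviation (input) up_rows :: "nat \<Rightarrow> (nat \<Rightarrow> int) \<Rightarrow> nat set" where
  "up_rows N mu \<equiv> {i \<in> {1..N}. mu + unit_tuple i \<in> partitions N}"

definition tuple_le :: "nat \<Rightarrow> (nat \<Rightarrow> int) \<Rightarrow> (nat \<Rightarrow> int) \<Rightarrow> bool" where
  "tuple_le N mu la \<longleftrightarrow> (\<forall>i\<in>{1..N}. mu i \<le> la i)"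

text \<open>For partitions this says that no column of the skew diagram contains two cells. The
  interlacing condition is spelled out for all pairs of rows, not only consecutive ones, so that it
  can be applied without first invoking monotonicity.\<close>

definition horizontal_strip :: "nat \<Rightarrow> (nat \<Rightarrow> int) \<Rightarrow> (nat \<Rightarrow> int) \<Rightarrow> bool" where
  "horizontal_strip N la mu \<longleftrightarrow>
     tuple_le N mu la \<and> (\<forall>i\<in>{1..N}. \<forall>j\<in>{1..N}. i < j \<longrightarrow> la j \<le> mu i)"

lemma partitions_antimono:
  "la \<in> partitions N \<Longrightarrow> 1 \<le> i \<Longrightarrow> i \<le> j \<Longrightarrow> j \<le> N \<Longrightarrow> la j \<le> la i"
  unfolding partitions_def by auto

lemma partitions_nonneg: "la \<in> partitions N \<Longrightarrow> 1 \<le> i \<Longrightarrow> i \<le> N \<Longrightarrow> 0 \<le> la i"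
  unfolding partitions_def by auto

lemma partitions_outside: "la \<in> partitions N \<Longrightarrow> i \<notin> {1..N} \<Longrightarrow> la i = 0"
  unfolding partitions_def int_tuples_def by auto

lemma partitionsI:
  assumes "\<And>i. i \<notin> {1..N} \<Longrightarrow> la i = 0"
    and "\<And>i j. 1 \<le> i \<Longrightarrow> i < j \<Longrightarrow> j \<le> N \<Longrightarrow> la j \<le> la i"
    and "\<And>i. 1 \<le> i \<Longrightarrow> i \<le> N \<Longrightarrow> 0 \<le> la i"
  shows "la \<in> partitions N"
  using assms unfolding partitions_def int_tuples_def
  by (auto simp: le_less)

lemma horizontal_stripD1:
  "horizontal_strip N la mu \<Longrightarrow> 1 \<le> i \<Longrightarrow> i \<le> N \<Longrightarrow> mu i \<le> la i"
  unfolding horizontal_strip_def tuple_le_def by auto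

lemma horizontal_stripD2:
  "horizontal_strip N la mu \<Longrightarrow> 1 \<le> i \<Longrightarrow> i < j \<Longrightarrow> j \<le> N \<Longrightarrow> la j \<le> mu i"
  unfolding horizontal_strip_def by auto

lemma horizontal_stripI:
  assumes "\<And>i. 1 \<le> i \<Longrightarrow> i \<le> N \<Longrightarrow> mu i \<le> la i"
    and "\<And>i j. 1 \<le> i \<Longrightarrow> i < j \<Longrightarrow> j \<le> N \<Longrightarrow> la j \<le> mu i"
  shows "horizontal_strip N la mu"
  using assms unfolding horizontal_strip_def tuple_le_def by auto

lemma unit_tuple_simps [simp]: "unit_tuple i i = 1" "k \<noteq> i \<Longrightarrow> unit_tuple i k = 0"
  by (auto simp: unit_tuple_def)

text \<open>In a horizontal strip the rows are independent. If \<open>mu i < la i\<close>, then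
  every later row of \<open>la\<close> is at most \<open>mu i \<le> la i - 1\<close>, and every
  earlier row of \<open>mu\<close> is at least \<open>la i \<ge> mu i + 1\<close>; so the last cell
  of row \<open>i\<close> can leave \<open>la\<close>, or its first cell join \<open>mu\<close>, and
  everything stays interlaced.\<close>

lemma strip_rows_eq_of_strip:
  assumes la: "la \<in> partitions N" and mu: "mu \<in> partitions N"
    and s: "horizontal_strip N la mu"
  shows "{i \<in> down_rows N la. horizontal_strip N (la - unit_tuple i) mu} =
           {i \<in> {1..N}. mu i < la i}" (is "?P = ?R")
    and "{i \<in> up_rows N mu. horizontal_strip N la (mu + unit_tuple i)} =
           {i \<in> {1..N}. mu i < la i}" (is "?Q = ?R")
proof -
  show "?P = ?R"
  proof (intro equalityI subsetI)
    fix i assume i: "i \<in> ?P"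
    then show "i \<in> ?R" using horizontal_stripD1[of N "la - unit_tuple i" mu i] by auto
  next
    fix i assume i: "i \<in> ?R"
    have "la - unit_tuple i \<in> partitions N"
    proof (rule partitionsI)
      show "(la - unit_tuple i) k = 0" if "k \<notin> {1..N}" for k
        using that i partitions_outside[OF la, of k] by (cases "k = i") auto
      show "(la - unit_tuple i) q \<le> (la - unit_tuple i) p" if "1 \<le> p" "p < q" "q \<le> N" for p q
        using that i horizontal_stripD2[OF s, of p q] partitions_antimono[OF la, of p q]
        by (cases "p = i"; cases "q = i") auto
      show "0 \<le> (la - unit_tuple i) p" if "1 \<le> p" "p \<le> N" for p
        using that i partitions_nonneg[OF mu, of p] partitions_nonneg[OF la, of p]
        by (cases "p = i") auto
    qed
    moreover have "horizontal_strip N (la - unit_tuple i) mu"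
    proof (rule horizontal_stripI)
      show "mu p \<le> (la - unit_tuple i) p" if "1 \<le> p" "p \<le> N" for p
        using that i horizontal_stripD1[OF s, of p] by (cases "p = i") auto
      show "(la - unit_tuple i) q \<le> mu p" if "1 \<le> p" "p < q" "q \<le> N" for p q
        using that horizontal_stripD2[OF s, of p q] by (cases "q = i") auto
    qed
    ultimately show "i \<in> ?P" using i by auto
  qed
  show "?Q = ?R"
  proof (intro equalityI subsetI)
    fix i assume i: "i \<in> ?Q"
    then show "i \<in> ?R" using horizontal_stripD1[of N la "mu + unit_tuple i" i] by auto
  next
    fix i assume i: "i \<in> ?R"
    have "mu + unit_tuple i \<in> partitions N"
    proof (rule partitionsI)
      show "(mu + unit_tuple i) k = 0" if "k \<notin> {1..N}" for k
        using that i partitions_outside[OF mu, of k] by (cases "k = i") auto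
      show "(mu + unit_tuple i) q \<le> (mu + unit_tuple i) p" if "1 \<le> p" "p < q" "q \<le> N" for p q
        using that i horizontal_stripD2[OF s, of p q] partitions_antimono[OF mu, of p q]
        by (cases "p = i"; cases "q = i") auto
      show "0 \<le> (mu + unit_tuple i) p" if "1 \<le> p" "p \<le> N" for p
        using that partitions_nonneg[OF mu, of p] by (cases "p = i") auto
    qed
    moreover have "horizontal_strip N la (mu + unit_tuple i)"
    proof (rule horizontal_stripI)
      show "(mu + unit_tuple i) p \<le> la p" if "1 \<le> p" "p \<le> N" for p
        using that i horizontal_stripD1[OF s, of p] by (cases "p = i") auto
      show "la q \<le> (mu + unit_tuple i) p" if "1 \<le> p" "p < q" "q \<le> N" for p q
        using that horizontal_stripD2[OF s, of p q] by (cases "p = i") auto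
    qed
    ultimately show "i \<in> ?Q" using i by auto
  qed
qed

text \<open>If lowering row \<open>i\<close> repairs the shape, every violation
  \<open>mu p < la q\<close> has \<open>q = i\<close>. With \<open>j = i - 1\<close> this forces
  \<open>la i - 1 \<le> mu j \<le> mu p < la i\<close>, hence \<open>la i = mu j + 1\<close>, and
  raising \<open>mu j\<close> by one repairs the shape as well.\<close>

lemma strip_after_lowering:
  assumes la: "la \<in> partitions N" and mu: "mu \<in> partitions N"
    and ns: "\<not> horizontal_strip N la mu"
    and i: "i \<in> down_rows N la" and s: "horizontal_strip N (la - unit_tuple i) mu"
  obtains j where "i = Suc j" "j \<in> up_rows N mu" "horizontal_strip N la (mu + unit_tuple j)"
proof -
  have N: "1 \<le> i" "i \<le> N" using i by auto
  have low: "mu k \<le> la k" if "1 \<le> k" "k \<le> N" for k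
    using horizontal_stripD1[OF s that] by (cases "k = i") auto
  obtain p where p: "1 \<le> p" "p < i" "mu p < la i"
  proof -
    obtain p q where pq: "1 \<le> p" "p < q" "q \<le> N" "mu p < la q"
      using ns low unfolding horizontal_strip_def tuple_le_def by (auto simp: not_le)
    with horizontal_stripD2[OF s pq(1-3)] have "q = i" by (cases "q = i") auto
    with pq that show ?thesis by auto
  qed
  define j where "j = i - 1"
  have j: "i = Suc j" "1 \<le> j" "p \<le> j" using p by (auto simp: j_def)
  have e: "la i = mu j + 1"
    using horizontal_stripD2[OF s, of j i]
      partitions_antimono[OF mu p(1) j(3)] p j N by auto
  have lj: "la i \<le> la j" using partitions_antimono[OF la, of j i] j N by auto
  \<comment> \<open>Row \<open>j\<close> is untouched by the lowering. Hence
    \<open>mu j + 1 = la i \<le> la j \<le> mu k\<close> for all earlier \<open>k\<close>, which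
    keeps the raised \<open>mu\<close> a partition.\<close>
  have s': "la j \<le> mu k" if "1 \<le> k" "k < j" for k
    using horizontal_stripD2[OF s, of k j] that j N by auto
  have "mu + unit_tuple j \<in> partitions N"
  proof (rule partitionsI)
    show "(mu + unit_tuple j) k = 0" if "k \<notin> {1..N}" for k
      using that j N partitions_outside[OF mu, of k] by (cases "k = j") auto
    show "(mu + unit_tuple j) q \<le> (mu + unit_tuple j) p" if "1 \<le> p" "p < q" "q \<le> N" for p q
      using that partitions_antimono[OF mu, of p q] s'[of p] lj e
      by (cases "p = j"; cases "q = j") auto
    show "0 \<le> (mu + unit_tuple j) p" if "1 \<le> p" "p \<le> N" for p
      using that partitions_nonneg[OF mu, of p] by (cases "p = j") auto
  qed
  moreover have "horizontal_strip N la (mu + unit_tuple j)"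
  proof (rule horizontal_stripI)
    show "(mu + unit_tuple j) p \<le> la p" if "1 \<le> p" "p \<le> N" for p
      using that e lj low[of p] by (cases "p = j") auto
    show "la q \<le> (mu + unit_tuple j) p" if "1 \<le> p" "p < q" "q \<le> N" for p q
      using that horizontal_stripD2[OF s, of p q] s'[of p] e lj j
      by (cases "p = j"; cases "q = i") auto
  qed
  ultimately show ?thesis using that j N by auto
qed

text \<open>The mirror image: now every violation \<open>mu p < la q\<close> has
  \<open>p = j\<close>, so \<open>mu j < la q \<le> la (Suc j) \<le> mu j + 1\<close>. The resulting
  equation also gives equal coefficients, since
  \<open>la (Suc j) - (j + 1) = mu j - j\<close>.\<close>

lemma strip_after_raising:
  assumes la: "la \<in> partitions N" and mu: "mu \<in> partitions N"
    and ns: "\<not> horizontal_strip N la mu"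
    and j: "j \<in> up_rows N mu" and s: "horizontal_strip N la (mu + unit_tuple j)"
  shows "Suc j \<in> down_rows N la" "horizontal_strip N (la - unit_tuple (Suc j)) mu"
    "la (Suc j) = mu j + 1"
proof -
  have N: "1 \<le> j" "j \<le> N" using j by auto
  have low: "mu k \<le> la k" if "1 \<le> k" "k \<le> N" for k
    using horizontal_stripD1[OF s that] by (cases "k = j") auto
  obtain q where q: "j < q" "q \<le> N" "mu j < la q"
  proof -
    obtain p q where pq: "1 \<le> p" "p < q" "q \<le> N" "mu p < la q"
      using ns low unfolding horizontal_strip_def tuple_le_def by (auto simp: not_le)
    with horizontal_stripD2[OF s pq(1-3)] have "p = j" by (cases "p = j") auto
    with pq that show ?thesis by auto
  qed
  define i where "i = Suc j"
  have i: "i = Suc j" "1 \<le> i" "i \<le> N" "i \<le> q" using q by (auto simp: i_def)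
  show e': "la (Suc j) = mu j + 1"
    using horizontal_stripD2[OF s, of j i] partitions_antimono[OF la, of i q] q i N by auto
  then have e: "la i = mu j + 1" by (simp add: i)
  have mj: "mu i \<le> mu j" using partitions_antimono[OF mu, of j i] i N by auto
  have s': "la k \<le> mu i" if "i < k" "k \<le> N" for k
    using horizontal_stripD2[OF s, of i k] that i N by auto
  have "la - unit_tuple i \<in> partitions N"
  proof (rule partitionsI)
    show "(la - unit_tuple i) k = 0" if "k \<notin> {1..N}" for k
      using that i N partitions_outside[OF la, of k] by (cases "k = i") auto
    show "(la - unit_tuple i) q \<le> (la - unit_tuple i) p" if "1 \<le> p" "p < q" "q \<le> N" for p q
      using that partitions_antimono[OF la, of p q] s'[of q] mj e
      by (cases "p = i"; cases "q = i") auto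
    show "0 \<le> (la - unit_tuple i) p" if "1 \<le> p" "p \<le> N" for p
      using that partitions_nonneg[OF la, of p] partitions_nonneg[OF mu, of j] e N
      by (cases "p = i") auto
  qed
  then show "Suc j \<in> down_rows N la" using i by auto
  have "horizontal_strip N (la - unit_tuple i) mu"
  proof (rule horizontal_stripI)
    show "mu p \<le> (la - unit_tuple i) p" if "1 \<le> p" "p \<le> N" for p
      using that e mj low[of p] by (cases "p = i") auto
    show "(la - unit_tuple i) q \<le> mu p" if "1 \<le> p" "p < q" "q \<le> N" for p q
      using that horizontal_stripD2[OF s, of p q] s'[of q] e mj i
      by (cases "p = j"; cases "q = i") auto
  qed
  then show "horizontal_strip N (la - unit_tuple (Suc j)) mu" by (simp add: i)
qed

text \<open>The integer content of the one-variable case. For a strip both sums run over the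
  nonempty rows, and their difference counts the cells, which is the exponent that differentiation
  brings down. Otherwise the shift from \<open>j\<close> to \<open>Suc j\<close> matches the two
  sums term by term.\<close>

lemma strip_rows_sum:
  fixes a :: int
  assumes la: "la \<in> partitions N" and mu: "mu \<in> partitions N"
  shows "(\<Sum>i\<in>{i \<in> down_rows N la. horizontal_strip N (la - unit_tuple i) mu}. la i - int i + a) -
      (\<Sum>i\<in>{i \<in> up_rows N mu. horizontal_strip N la (mu + unit_tuple i)}. mu i - int i + a) =
      (if horizontal_strip N la mu then \<Sum>i\<in>{1..N}. la i - mu i else 0)"
    (is "sum ?f ?P - sum ?g ?Q = _")
proof (cases "horizontal_strip N la mu")
  case True
  let ?R = "{i \<in> {1..N}. mu i < la i}"
  have "sum ?f ?P - sum ?g ?Q = (\<Sum>i\<in>?R. la i - mu i)"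
    unfolding strip_rows_eq_of_strip[OF la mu True] sum_subtractf[symmetric] by simp
  also have "\<dots> = (\<Sum>i\<in>{1..N}. la i - mu i)"
    by (rule sum.mono_neutral_left) (use horizontal_stripD1[OF True] in force)+
  finally show ?thesis using True by simp
next
  case False
  have e: "?P = Suc ` ?Q"
  proof (intro equalityI subsetI)
    fix i assume "i \<in> ?P"
    then show "i \<in> Suc ` ?Q" using strip_after_lowering[OF la mu False, of i] by blast
  next
    fix i assume "i \<in> Suc ` ?Q"
    then show "i \<in> ?P" using strip_after_raising[OF la mu False] by blast
  qed
  have "sum ?f ?P = sum (?f \<circ> Suc) ?Q" unfolding e by (rule sum.reindex) simp
  also have "\<dots> = sum ?g ?Q"
    by (rule sum.cong) (use strip_after_raising(3)[OF la mu False] in auto)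
  finally show ?thesis using False by simp
qed

section \<open>Skew Schur polynomials with the number of variables independent of the number of
  rows\<close>

definition strip_size :: "nat \<Rightarrow> (nat \<Rightarrow> int) \<Rightarrow> (nat \<Rightarrow> int) \<Rightarrow> nat" where
  "strip_size N la mu = nat (\<Sum>i\<in>{1..N}. la i - mu i)"

text \<open>For partitions this is the skew Schur polynomial in the single variable
  \<open>x\<close>: a filling with one repeated entry is semistandard only if no column has two
  cells.\<close>

definition strip_weight ::
    "nat \<Rightarrow> 'a::comm_ring_1 \<Rightarrow> (nat \<Rightarrow> int) \<Rightarrow> (nat \<Rightarrow> int) \<Rightarrow> 'a" where
  "strip_weight N x la mu = (if horizontal_strip N la mu then x ^ strip_size N la mu else 0)"

definition bounded_tableaux ::
    "nat \<Rightarrow> nat \<Rightarrow> (nat \<Rightarrow> int) \<Rightarrow> (nat \<Rightarrow> int) \<Rightarrow> (nat \<times> int \<Rightarrow> nat) set" where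
  "bounded_tableaux N n la mu =
    {T \<in> skew_diagram N la mu \<rightarrow>\<^sub>E {1..n}.
      (\<forall>i j j'. (i, j) \<in> skew_diagram N la mu \<and> (i, j') \<in> skew_diagram N la mu \<and> j < j'
         \<longrightarrow> T (i, j) \<le> T (i, j')) \<and>
      (\<forall>i i' j. (i, j) \<in> skew_diagram N la mu \<and> (i', j) \<in> skew_diagram N la mu \<and> i < i'
         \<longrightarrow> T (i, j) < T (i', j))}"

text \<open>The variables are arbitrary elements of a commutative ring, so that the induction on
  \<open>n\<close> needs only a derivation sending each of them to 1 and nothing about
  polynomials.\<close>

definition bounded_schur ::
    "nat \<Rightarrow> (nat \<Rightarrow> 'a::comm_ring_1) \<Rightarrow> nat \<Rightarrow> (nat \<Rightarrow> int) \<Rightarrow> (nat \<Rightarrow> int) \<Rightarrow> 'a" where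
  "bounded_schur N x n la mu =
    (if tuple_le N mu la
     then \<Sum>T\<in>bounded_tableaux N n la mu. \<Prod>c\<in>skew_diagram N la mu. x (T c)
     else 0)"

lemma skew_schur_eq_bounded: "skew_schur N la mu = bounded_schur N X N la mu"
  unfolding skew_schur_def bounded_schur_def semistandard_tableaux_def bounded_tableaux_def
    tuple_le_def ..

section \<open>Derivations and the one-variable identity\<close>

locale unit_derivation =
  fixes D :: "'a::comm_ring_1 \<Rightarrow> 'a"
  assumes add: "D (p + q) = D p + D q"
    and mult: "D (p * q) = D p * q + p * D q"
begin

lemma zero: "D 0 = 0" using add[of 0 0] by simp

lemma one: "D 1 = 0" using mult[of 1 1] by simp

lemma sum: "D (sum f A) = (\<Sum>i\<in>A. D (f i))"
  by (induction A rule: infinite_finite_induct) (auto simp: zero add)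

lemma power:
  assumes "D x = 1"
  shows "D (x ^ k) = of_nat k * x ^ (k - 1)"
proof (induction k)
  case (Suc k)
  show ?case
    by (cases k) (use Suc in \<open>simp_all add: mult one assms algebra_simps\<close>)
qed (simp add: one)

text \<open>All nonzero weights on the right carry the same power of \<open>x\<close>, because each
  of their shapes has one cell fewer than \<open>la/mu\<close>. Comparing coefficients of that power
  leaves \<open>strip_rows_sum\<close>.\<close>

lemma strip_weight:
  assumes x: "D x = 1" and la: "la \<in> partitions N" and mu: "mu \<in> partitions N"
  shows "D (strip_weight N x la mu) =
    (\<Sum>i\<in>down_rows N la. of_int (la i - int i + a) * strip_weight N x (la - unit_tuple i) mu) -
    (\<Sum>i\<in>up_rows N mu. of_int (mu i - int i + a) * strip_weight N x la (mu + unit_tuple i))"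
proof -
  \<comment> \<open>The size after the loss of one cell. For an empty strip it truncates to 0, which
    is harmless because the factor in front is then 0.\<close>
  define k where "k = nat ((\<Sum>i\<in>{1..N}. la i - mu i) - 1)"
  have sz: "strip_size N (la - unit_tuple i) mu = k" "strip_size N la (mu + unit_tuple i) = k"
    if "i \<in> {1..N}" for i
    using that unfolding strip_size_def k_def
    by (simp_all add: sum_subtractf sum.distrib unit_tuple_def algebra_simps)
  have "(\<Sum>i\<in>down_rows N la. of_int (la i - int i + a) * strip_weight N x (la - unit_tuple i) mu) =
      (\<Sum>i\<in>{i \<in> down_rows N la. horizontal_strip N (la - unit_tuple i) mu}.
        of_int (la i - int i + a) * x ^ k)"
    by (subst sum.inter_filter) (auto simp: strip_weight_def sz intro!: sum.cong)
  moreover have "(\<Sum>i\<in>up_rows N mu. of_int (mu i - int i + a) * strip_weight N x la (mu + unit_tuple i)) =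
      (\<Sum>i\<in>{i \<in> up_rows N mu. horizontal_strip N la (mu + unit_tuple i)}.
        of_int (mu i - int i + a) * x ^ k)"
    by (subst sum.inter_filter) (auto simp: strip_weight_def sz intro!: sum.cong)
  moreover have "D (strip_weight N x la mu) =
      of_int (if horizontal_strip N la mu then \<Sum>i\<in>{1..N}. la i - mu i else 0) * x ^ k"
  proof (cases "horizontal_strip N la mu")
    case True
    have nn: "0 \<le> (\<Sum>i\<in>{1..N}. la i - mu i)"
      by (rule sum_nonneg) (use horizontal_stripD1[OF True] in auto)
    have "k = strip_size N la mu - 1" unfolding k_def strip_size_def by simp
    moreover have "of_nat (strip_size N la mu) = (of_int (\<Sum>i\<in>{1..N}. la i - mu i) :: 'a)"
      unfolding strip_size_def using nn by (metis of_int_of_nat_eq int_nat_eq)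
    ultimately show ?thesis using True by (simp add: strip_weight_def power[OF x] del: of_int_sum)
  qed (simp add: strip_weight_def zero)
  ultimately show ?thesis
    unfolding strip_rows_sum[OF la mu, of a, symmetric]
    by (simp only: of_int_diff of_int_sum left_diff_distrib sum_distrib_right)
qed

end

section \<open>Bounded tableaux, and removal of the cells with the largest entry\<close>

lemma skew_diagram_iff [simp]:
  "(i, j) \<in> skew_diagram N la mu \<longleftrightarrow> 1 \<le> i \<and> i \<le> N \<and> mu i < j \<and> j \<le> la i"
  by (auto simp: skew_diagram_def)

lemma skew_diagram_Sigma: "skew_diagram N la mu = (SIGMA i:{1..N}. {mu i<..la i})"
  by (auto simp: skew_diagram_def)

lemma finite_skew_diagram [simp]: "finite (skew_diagram N la mu)"
  by (simp add: skew_diagram_Sigma)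

lemma card_skew_diagram:
  assumes "tuple_le N mu la"
  shows "card (skew_diagram N la mu) = strip_size N la mu"
proof -
  have "card (skew_diagram N la mu) = (\<Sum>i\<in>{1..N}. nat (la i - mu i))"
    by (simp add: skew_diagram_Sigma)
  also have "\<dots> = strip_size N la mu"
  proof -
    have "int (\<Sum>i\<in>{1..N}. nat (la i - mu i)) = (\<Sum>i\<in>{1..N}. la i - mu i)"
      unfolding of_nat_sum by (rule sum.cong) (use assms in \<open>auto simp: tuple_le_def\<close>)
    then show ?thesis unfolding strip_size_def by (metis nat_int)
  qed
  finally show ?thesis .
qed

lemma finite_bounded_tableaux [simp]: "finite (bounded_tableaux N n la mu)"
  by (rule finite_subset[of _ "skew_diagram N la mu \<rightarrow>\<^sub>E {1..n}"])
    (auto simp: bounded_tableaux_def intro: finite_PiE)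

lemma bounded_tableaux_range:
  "T \<in> bounded_tableaux N n la mu \<Longrightarrow> 1 \<le> i \<Longrightarrow> i \<le> N \<Longrightarrow> mu i < j \<Longrightarrow> j \<le> la i \<Longrightarrow>
     1 \<le> T (i, j) \<and> T (i, j) \<le> n"
  unfolding bounded_tableaux_def by (auto simp: PiE_iff)

lemma bounded_tableaux_row:
  "T \<in> bounded_tableaux N n la mu \<Longrightarrow> 1 \<le> i \<Longrightarrow> i \<le> N \<Longrightarrow> mu i < j \<Longrightarrow> j \<le> j' \<Longrightarrow> j' \<le> la i \<Longrightarrow>
     T (i, j) \<le> T (i, j')"
  unfolding bounded_tableaux_def by (cases "j = j'") auto

lemma bounded_tableaux_column:
  "T \<in> bounded_tableaux N n la mu \<Longrightarrow> 1 \<le> i \<Longrightarrow> i < i' \<Longrightarrow> i' \<le> N \<Longrightarrow>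
     mu i < j \<Longrightarrow> j \<le> la i \<Longrightarrow> mu i' < j \<Longrightarrow> j \<le> la i' \<Longrightarrow> T (i, j) < T (i', j)"
  unfolding bounded_tableaux_def by auto

lemma bounded_tableaux_outside:
  "T \<in> bounded_tableaux N n la mu \<Longrightarrow> c \<notin> skew_diagram N la mu \<Longrightarrow> T c = undefined"
  unfolding bounded_tableaux_def by (cases c) (auto simp: PiE_iff extensional_def)

lemma bounded_tableauxI:
  assumes "\<And>i j. 1 \<le> i \<Longrightarrow> i \<le> N \<Longrightarrow> mu i < j \<Longrightarrow> j \<le> la i \<Longrightarrow> 1 \<le> T (i, j) \<and> T (i, j) \<le> n"
    and "\<And>c. c \<notin> skew_diagram N la mu \<Longrightarrow> T c = undefined"
    and "\<And>i j j'. 1 \<le> i \<Longrightarrow> i \<le> N \<Longrightarrow> mu i < j \<Longrightarrow> j < j' \<Longrightarrow> j' \<le> la i \<Longrightarrow> T (i, j) \<le> T (i, j')"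
    and "\<And>i i' j. 1 \<le> i \<Longrightarrow> i < i' \<Longrightarrow> i' \<le> N \<Longrightarrow> mu i < j \<Longrightarrow> j \<le> la i \<Longrightarrow>
           mu i' < j \<Longrightarrow> j \<le> la i' \<Longrightarrow> T (i, j) < T (i', j)"
  shows "T \<in> bounded_tableaux N n la mu"
  using assms unfolding bounded_tableaux_def by (auto simp: PiE_iff extensional_def split_paired_all)

text \<open>The outer shape left after the cells with entry above \<open>n\<close> are deleted.
  Inserting \<open>mu i\<close> makes a row with no remaining cell end at \<open>mu i\<close> and
  keeps \<open>Max\<close> away from the empty set.\<close>

definition lower_shape ::
    "nat \<Rightarrow> nat \<Rightarrow> (nat \<Rightarrow> int) \<Rightarrow> (nat \<Rightarrow> int) \<Rightarrow> (nat \<times> int \<Rightarrow> nat) \<Rightarrow> nat \<Rightarrow> int" where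
  "lower_shape N n la mu T i =
     (if i \<in> {1..N} then Max (insert (mu i) {j \<in> {mu i<..la i}. T (i, j) \<le> n}) else 0)"

lemma finite_row [simp]: "finite {j :: int. a < j \<and> j \<le> b \<and> P j}"
  by (rule finite_subset[of _ "{a<..b}"]) auto

lemma lower_shape_bounds:
  assumes "tuple_le N mu la" "1 \<le> i" "i \<le> N"
  shows "mu i \<le> lower_shape N n la mu T i" "lower_shape N n la mu T i \<le> la i"
  using assms by (auto simp: lower_shape_def tuple_le_def)

text \<open>Rows increase weakly, so the entries at most \<open>n\<close> fill an initial segment of
  each row.\<close>

lemma le_lower_shape_iff:
  assumes T: "T \<in> bounded_tableaux N n' la mu" and i: "1 \<le> i" "i \<le> N" and j: "mu i < j" "j \<le> la i"
  shows "j \<le> lower_shape N n la mu T i \<longleftrightarrow> T (i, j) \<le> n"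
proof
  assume "T (i, j) \<le> n"
  then show "j \<le> lower_shape N n la mu T i" using i j by (auto simp: lower_shape_def intro: Max_ge)
next
  let ?J = "{j \<in> {mu i<..la i}. T (i, j) \<le> n}"
  assume le: "j \<le> lower_shape N n la mu T i"
  have "Max (insert (mu i) ?J) \<in> insert (mu i) ?J" by (rule Max_in) auto
  with le i j have "lower_shape N n la mu T i \<in> ?J" by (auto simp: lower_shape_def)
  then show "T (i, j) \<le> n" using bounded_tableaux_row[OF T i j(1) le] by auto
qed

text \<open>Two deleted cells cannot share a column. If row \<open>q\<close> of \<open>la\<close>
  reached beyond row \<open>p\<close> of the lower shape, then column \<open>la q\<close> would meet
  both rows, with an entry above \<open>n\<close> in row \<open>p\<close> and a strictly larger one
  in row \<open>q\<close>, exceeding \<open>Suc n\<close>.\<close>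

lemma lower_shape_strip:
  assumes T: "T \<in> bounded_tableaux N (Suc n) la mu"
    and la: "la \<in> partitions N" and mu: "mu \<in> partitions N" and le: "tuple_le N mu la"
  shows "horizontal_strip N la (lower_shape N n la mu T)"
proof (rule horizontal_stripI)
  fix p q :: nat assume pq: "1 \<le> p" "p < q" "q \<le> N"
  show "la q \<le> lower_shape N n la mu T p"
  proof (rule ccontr)
    assume c: "\<not> la q \<le> lower_shape N n la mu T p"
    have p: "mu p < la q" "la q \<le> la p" "mu q \<le> mu p"
      using c lower_shape_bounds(1)[OF le, of p n T] partitions_antimono[OF la, of p q]
        partitions_antimono[OF mu, of p q] pq by auto
    have "T (p, la q) > n" using le_lower_shape_iff[OF T, of p "la q" n] c p pq by auto
    moreover have "T (p, la q) < T (q, la q)"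
      using bounded_tableaux_column[OF T, of p q "la q"] p pq by auto
    moreover have "T (q, la q) \<le> Suc n" using bounded_tableaux_range[OF T, of q "la q"] p pq by auto
    ultimately show False by simp
  qed
qed (use lower_shape_bounds[OF le] in auto)

text \<open>Interlacing alone makes the rows decrease: \<open>nu q \<le> la q \<le> nu p\<close> for
  \<open>p < q\<close>.\<close>

lemma strip_lower_partition:
  assumes la: "la \<in> partitions N" and s: "horizontal_strip N la nu"
    and le: "tuple_le N mu nu" and mu: "mu \<in> partitions N"
    and out: "\<And>i. i \<notin> {1..N} \<Longrightarrow> nu i = 0"
  shows "nu \<in> partitions N"
proof (rule partitionsI)
  show "nu q \<le> nu p" if "1 \<le> p" "p < q" "q \<le> N" for p q
    using horizontal_stripD1[OF s, of q] horizontal_stripD2[OF s, of p q] that by auto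
  show "0 \<le> nu p" if "1 \<le> p" "p \<le> N" for p
    using le partitions_nonneg[OF mu, of p] that unfolding tuple_le_def by force
qed (rule out)

lemma lower_tableau:
  assumes T: "T \<in> bounded_tableaux N (Suc n) la mu" and le: "tuple_le N mu la"
    and nu: "nu = lower_shape N n la mu T"
  shows "restrict T (skew_diagram N nu mu) \<in> bounded_tableaux N n nu mu"
proof (rule bounded_tableauxI)
  have b: "nu i \<le> la i" if "1 \<le> i" "i \<le> N" for i
    using lower_shape_bounds(2)[OF le that] nu by simp
  show "1 \<le> restrict T (skew_diagram N nu mu) (i, j) \<and> restrict T (skew_diagram N nu mu) (i, j) \<le> n"
    if "1 \<le> i" "i \<le> N" "mu i < j" "j \<le> nu i" for i j
    using that b[of i] le_lower_shape_iff[OF T, of i j n] bounded_tableaux_range[OF T, of i j] nu by auto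
  show "restrict T (skew_diagram N nu mu) (i, j) \<le> restrict T (skew_diagram N nu mu) (i, j')"
    if "1 \<le> i" "i \<le> N" "mu i < j" "j < j'" "j' \<le> nu i" for i j j'
    using that b[of i] bounded_tableaux_row[OF T, of i j j'] by auto
  show "restrict T (skew_diagram N nu mu) (i, j) < restrict T (skew_diagram N nu mu) (i', j)"
    if "1 \<le> i" "i < i'" "i' \<le> N" "mu i < j" "j \<le> nu i" "mu i' < j" "j \<le> nu i'" for i i' j
    using that b[of i] b[of i'] bounded_tableaux_column[OF T, of i i' j] by auto
qed auto

definition extend_tableau ::
    "nat \<Rightarrow> nat \<Rightarrow> (nat \<Rightarrow> int) \<Rightarrow> (nat \<Rightarrow> int) \<Rightarrow> (nat \<Rightarrow> int) \<Rightarrow> (nat \<times> int \<Rightarrow> nat) \<Rightarrow>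
      nat \<times> int \<Rightarrow> nat" where
  "extend_tableau N n la nu mu T =
     restrict (\<lambda>c. if c \<in> skew_diagram N nu mu then T c else Suc n) (skew_diagram N la mu)"

text \<open>Columns stay strict because a cell of row \<open>i\<close> with another cell below it in
  row \<open>i'\<close> lies in column \<open>j \<le> la i' \<le> nu i\<close>; its entry therefore
  comes from \<open>T\<close> and is at most \<open>n\<close>.\<close>

lemma extend_tableau_bounded:
  assumes T: "T \<in> bounded_tableaux N n nu mu" and s: "horizontal_strip N la nu"
  shows "extend_tableau N n la nu mu T \<in> bounded_tableaux N (Suc n) la mu"
proof (rule bounded_tableauxI)
  let ?E = "extend_tableau N n la nu mu T"
  show "1 \<le> ?E (i, j) \<and> ?E (i, j) \<le> Suc n"
    if "1 \<le> i" "i \<le> N" "mu i < j" "j \<le> la i" for i j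
    using that bounded_tableaux_range[OF T, of i j] by (auto simp: extend_tableau_def)
  show "?E (i, j) \<le> ?E (i, j')"
    if "1 \<le> i" "i \<le> N" "mu i < j" "j < j'" "j' \<le> la i" for i j j'
    using that bounded_tableaux_range[OF T, of i j] bounded_tableaux_row[OF T, of i j j']
    by (auto simp: extend_tableau_def)
  show "?E (i, j) < ?E (i', j)"
    if "1 \<le> i" "i < i'" "i' \<le> N" "mu i < j" "j \<le> la i" "mu i' < j" "j \<le> la i'" for i i' j
    using that bounded_tableaux_range[OF T, of i j] bounded_tableaux_column[OF T, of i i' j]
      horizontal_stripD2[OF s, of i i'] by (auto simp: extend_tableau_def)
qed (auto simp: extend_tableau_def)

text \<open>Together with the next two lemmas this shows that deleting the cells with entry
  \<open>Suc n\<close> and filling a strip with that entry are mutually inverse.\<close>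

lemma lower_shape_extend:
  assumes T: "T \<in> bounded_tableaux N n nu mu" and nu: "nu \<in> partitions N"
    and s: "horizontal_strip N la nu" and le: "tuple_le N mu nu"
  shows "lower_shape N n la mu (extend_tableau N n la nu mu T) = nu"
proof
  fix i
  show "lower_shape N n la mu (extend_tableau N n la nu mu T) i = nu i"
  proof (cases "i \<in> {1..N}")
    case True
    have b: "mu i \<le> nu i" "nu i \<le> la i"
      using le True horizontal_stripD1[OF s, of i] unfolding tuple_le_def by auto
    have "extend_tableau N n la nu mu T (i, j) \<le> n \<longleftrightarrow> j \<le> nu i" if "mu i < j" "j \<le> la i" for j
      using that True bounded_tableaux_range[OF T, of i j] by (auto simp: extend_tableau_def)
    then have "{j \<in> {mu i<..la i}. extend_tableau N n la nu mu T (i, j) \<le> n} = {mu i<..nu i}"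
      using b by auto
    moreover have "insert (mu i) {mu i<..nu i} = {mu i..nu i}" using b by auto
    moreover have "Max {mu i..nu i} = nu i" using b by (intro Max_eqI) auto
    ultimately show ?thesis using True by (simp add: lower_shape_def)
  next
    case False
    then show ?thesis using partitions_outside[OF nu False] by (auto simp: lower_shape_def)
  qed
qed

lemma extend_lower_tableau:
  assumes T: "T \<in> bounded_tableaux N (Suc n) la mu" and le: "tuple_le N mu la"
    and nu: "nu = lower_shape N n la mu T"
  shows "extend_tableau N n la nu mu (restrict T (skew_diagram N nu mu)) = T"
proof
  fix c :: "nat \<times> int"
  obtain i j where c: "c = (i, j)" by (cases c)
  show "extend_tableau N n la nu mu (restrict T (skew_diagram N nu mu)) c = T c"
  proof (cases "c \<in> skew_diagram N la mu")
    case True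
    then show ?thesis
      using c le_lower_shape_iff[OF T, of i j n] bounded_tableaux_range[OF T, of i j] nu
      by (auto simp: extend_tableau_def)
  next
    case False
    then show ?thesis using bounded_tableaux_outside[OF T False] by (auto simp: extend_tableau_def)
  qed
qed

lemma restrict_extend_tableau:
  assumes T: "T \<in> bounded_tableaux N n nu mu" and s: "horizontal_strip N la nu"
  shows "restrict (extend_tableau N n la nu mu T) (skew_diagram N nu mu) = T"
proof
  fix c :: "nat \<times> int"
  obtain i j where c: "c = (i, j)" by (cases c)
  show "restrict (extend_tableau N n la nu mu T) (skew_diagram N nu mu) c = T c"
    using horizontal_stripD1[OF s, of i] bounded_tableaux_outside[OF T, of c] c
    by (auto simp: extend_tableau_def restrict_def)
qed

text \<open>The diagram splits into the cells of \<open>nu/mu\<close>, where the entries are those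
  of \<open>T\<close>, and the cells of the strip \<open>la/nu\<close>, each contributing one factor
  \<open>x (Suc n)\<close>.\<close>

lemma extend_tableau_weight:
  assumes le: "tuple_le N mu nu" and s: "horizontal_strip N la nu"
  shows "(\<Prod>c\<in>skew_diagram N la mu. x (extend_tableau N n la nu mu T c)) =
    (\<Prod>c\<in>skew_diagram N nu mu. x (T c)) * strip_weight N (x (Suc n)) la nu"
proof -
  let ?E = "extend_tableau N n la nu mu T"
  have s': "tuple_le N nu la" using s by (simp add: horizontal_strip_def)
  have b: "mu i \<le> nu i" "nu i \<le> la i" if "1 \<le> i" "i \<le> N" for i
    using le s' that by (auto simp: tuple_le_def)
  have un: "skew_diagram N la mu = skew_diagram N nu mu \<union> skew_diagram N la nu"
    using b by (fastforce simp: skew_diagram_def)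
  have dj: "skew_diagram N nu mu \<inter> skew_diagram N la nu = {}" by (auto simp: skew_diagram_def)
  have "(\<Prod>c\<in>skew_diagram N la mu. x (?E c)) =
      (\<Prod>c\<in>skew_diagram N nu mu. x (?E c)) * (\<Prod>c\<in>skew_diagram N la nu. x (?E c))"
    unfolding un by (rule prod.union_disjoint) (use dj in auto)
  also have "(\<Prod>c\<in>skew_diagram N nu mu. x (?E c)) = (\<Prod>c\<in>skew_diagram N nu mu. x (T c))"
    by (rule prod.cong) (auto simp: extend_tableau_def un)
  also have "(\<Prod>c\<in>skew_diagram N la nu. x (?E c)) = (\<Prod>c\<in>skew_diagram N la nu. x (Suc n))"
    by (rule prod.cong) (use dj in \<open>auto simp: extend_tableau_def un\<close>)
  also have "\<dots> = strip_weight N (x (Suc n)) la nu"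
    using s by (simp add: strip_weight_def card_skew_diagram[OF s'])
  finally show ?thesis .
qed

section \<open>The branching rule, with finitely many intermediate shapes\<close>

definition subpartitions :: "nat \<Rightarrow> (nat \<Rightarrow> int) \<Rightarrow> (nat \<Rightarrow> int) set" where
  "subpartitions N la = {nu \<in> partitions N. tuple_le N nu la}"

lemma finite_subpartitions: "finite (subpartitions N la)"
proof (rule finite_subset)
  \<comment> \<open>Inserting 0 keeps \<open>Max\<close> meaningful when
    \<open>N = 0\<close>.\<close>
  let ?B = "{0..Max (insert 0 (la ` {1..N}))}"
  show "finite {nu. \<forall>i. (i \<in> {1..N} \<longrightarrow> nu i \<in> ?B) \<and> (i \<notin> {1..N} \<longrightarrow> nu i = 0)}"
    by (rule finite_set_of_finite_funs) auto
  show "subpartitions N la \<subseteq> {nu. \<forall>i. (i \<in> {1..N} \<longrightarrow> nu i \<in> ?B) \<and> (i \<notin> {1..N} \<longrightarrow> nu i = 0)}"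
  proof (intro subsetI CollectI allI conjI impI)
    fix nu i assume nu: "nu \<in> subpartitions N la"
    then have p: "nu \<in> partitions N" and le: "tuple_le N nu la" by (auto simp: subpartitions_def)
    { assume i: "i \<in> {1..N}"
      then have "nu i \<le> la i" using le by (auto simp: tuple_le_def)
      also have "la i \<le> Max (insert 0 (la ` {1..N}))" using i by (intro Max_ge) auto
      finally show "nu i \<in> ?B" using partitions_nonneg[OF p, of i] i by auto }
    { assume "i \<notin> {1..N}" then show "nu i = 0" by (rule partitions_outside[OF p]) }
  qed
qed

text \<open>A tableau with entries up to \<open>Suc n\<close> is the same as a lower shape
  \<open>nu\<close> with \<open>la/nu\<close> a horizontal strip, together with a tableau of shape
  \<open>nu/mu\<close> with entries up to \<open>n\<close>.\<close>

lemma bounded_schur_branching_strips: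
  assumes la: "la \<in> partitions N" and mu: "mu \<in> partitions N" and le: "tuple_le N mu la"
  shows "bounded_schur N x (Suc n) la mu =
    (\<Sum>nu\<in>{nu \<in> subpartitions N la. tuple_le N mu nu \<and> horizontal_strip N la nu}.
       bounded_schur N x n nu mu * strip_weight N (x (Suc n)) la nu)"
proof -
  let ?V = "{nu \<in> subpartitions N la. tuple_le N mu nu \<and> horizontal_strip N la nu}"
  have fin: "finite ?V" using finite_subpartitions by simp
  have V: "lower_shape N n la mu T \<in> ?V" if T: "T \<in> bounded_tableaux N (Suc n) la mu" for T
  proof -
    have s: "horizontal_strip N la (lower_shape N n la mu T)"
      by (rule lower_shape_strip[OF T la mu le])
    have l: "tuple_le N mu (lower_shape N n la mu T)"
      using lower_shape_bounds[OF le] by (auto simp: tuple_le_def)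
    have "lower_shape N n la mu T \<in> partitions N"
      by (rule strip_lower_partition[OF la s l mu]) (auto simp: lower_shape_def)
    with s l show ?thesis by (auto simp: subpartitions_def horizontal_strip_def)
  qed
  have "bounded_schur N x (Suc n) la mu =
      (\<Sum>T\<in>bounded_tableaux N (Suc n) la mu. \<Prod>c\<in>skew_diagram N la mu. x (T c))"
    using le by (simp add: bounded_schur_def)
  also have "\<dots> = (\<Sum>(nu, T)\<in>(SIGMA nu:?V. bounded_tableaux N n nu mu).
      (\<Prod>c\<in>skew_diagram N nu mu. x (T c)) * strip_weight N (x (Suc n)) la nu)"
  proof (rule sum.reindex_bij_witness[where
        i = "\<lambda>(nu, T). extend_tableau N n la nu mu T" and
        j = "\<lambda>T. (lower_shape N n la mu T,
               restrict T (skew_diagram N (lower_shape N n la mu T) mu))"], goal_cases)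
    case (1 T)
    then show ?case using extend_lower_tableau[OF _ le refl, of T n] by simp
  next
    case (2 T)
    then show ?case using V[of T] lower_tableau[OF _ le refl, of T n] by simp
  next
    case (3 y)
    then show ?case
      by (auto simp: subpartitions_def lower_shape_extend restrict_extend_tableau)
  next
    case (4 y)
    then show ?case by (auto simp: subpartitions_def intro: extend_tableau_bounded)
  next
    case (5 T)
    let ?nu = "lower_shape N n la mu T"
    have "(\<Prod>c\<in>skew_diagram N la mu. x (T c)) = (\<Prod>c\<in>skew_diagram N la mu.
        x (extend_tableau N n la ?nu mu (restrict T (skew_diagram N ?nu mu)) c))"
      using extend_lower_tableau[OF 5 le refl] by simp
    also have "\<dots> = (\<Prod>c\<in>skew_diagram N ?nu mu. x (restrict T (skew_diagram N ?nu mu) c)) *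
        strip_weight N (x (Suc n)) la ?nu"
      by (rule extend_tableau_weight) (use V[OF 5] in auto)
    finally show ?case by simp
  qed
  also have "\<dots> = (\<Sum>nu\<in>?V. bounded_schur N x n nu mu * strip_weight N (x (Suc n)) la nu)"
    using fin by (subst sum.Sigma[symmetric]) (auto simp: bounded_schur_def sum_distrib_right)
  finally show ?thesis .
qed

text \<open>The branching rule as a matrix product; the additional terms vanish. The freedom in
  \<open>F\<close> lets \<open>la\<close> and \<open>la - unit_tuple i\<close> be expanded over one
  common index set in the induction.\<close>

lemma bounded_schur_branching:
  assumes la: "la \<in> partitions N" and mu: "mu \<in> partitions N"
    and fin: "finite F" and F: "subpartitions N la \<subseteq> F" and Fp: "F \<subseteq> partitions N"
  shows "bounded_schur N x (Suc n) la mu =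
    (\<Sum>nu\<in>F. bounded_schur N x n nu mu * strip_weight N (x (Suc n)) la nu)"
proof (cases "tuple_le N mu la")
  case True
  show ?thesis unfolding bounded_schur_branching_strips[OF la mu True]
  proof (rule sum.mono_neutral_left[OF fin])
    show "{nu \<in> subpartitions N la. tuple_le N mu nu \<and> horizontal_strip N la nu} \<subseteq> F"
      using F by auto
  next
    show "\<forall>nu\<in>F - {nu \<in> subpartitions N la. tuple_le N mu nu \<and> horizontal_strip N la nu}.
        bounded_schur N x n nu mu * strip_weight N (x (Suc n)) la nu = 0"
      using Fp by (auto simp: bounded_schur_def strip_weight_def subpartitions_def horizontal_strip_def)
  qed
next
  case False
  have "bounded_schur N x n nu mu * strip_weight N (x (Suc n)) la nu = 0" for nu
    using False by (force simp: bounded_schur_def strip_weight_def horizontal_strip_def tuple_le_def)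
  then show ?thesis using False by (simp add: bounded_schur_def)
qed

section \<open>The case of no variables\<close>

lemma bounded_schur_0:
  assumes la: "la \<in> partitions N" and mu: "mu \<in> partitions N"
  shows "bounded_schur N x 0 la mu = (if la = mu then 1 else 0)"
proof (cases "la = mu")
  case True
  have "skew_diagram N la la = {}" by (auto simp: skew_diagram_def)
  moreover have "bounded_tableaux N 0 la la = {\<lambda>_. undefined}"
    unfolding bounded_tableaux_def calculation by simp
  ultimately show ?thesis using True by (simp add: bounded_schur_def tuple_le_def)
next
  case False
  have "bounded_tableaux N 0 la mu = {}" if le: "tuple_le N mu la"
  proof (rule ccontr)
    assume "bounded_tableaux N 0 la mu \<noteq> {}"
    then obtain T where T: "T \<in> bounded_tableaux N 0 la mu" by auto
    obtain i where i: "la i \<noteq> mu i" using False by auto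
    then have i1: "i \<in> {1..N}" using partitions_outside[OF la, of i] partitions_outside[OF mu, of i] by force
    then have "mu i < la i" using le i unfolding tuple_le_def by force
    then show False using bounded_tableaux_range[OF T, of i "la i"] i1 by auto
  qed
  then show ?thesis using False by (simp add: bounded_schur_def)
qed

text \<open>With no variables the matrix of skew Schur polynomials is the identity, so both sums
  reduce to the rows with \<open>la = mu + unit_tuple i\<close>. There
  \<open>la i = mu i + 1\<close>, so the coefficients agree.\<close>

lemma bounded_schur_0_cancel:
  fixes x :: "nat \<Rightarrow> 'a::comm_ring_1"
  assumes la: "la \<in> partitions N" and mu: "mu \<in> partitions N"
  shows "(\<Sum>i\<in>down_rows N la. of_int (la i - int i + a) * bounded_schur N x 0 (la - unit_tuple i) mu) =
    (\<Sum>i\<in>up_rows N mu. of_int (mu i - int i + 1 + a) * bounded_schur N x 0 la (mu + unit_tuple i))"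
proof -
  have eq: "la - unit_tuple i = mu \<longleftrightarrow> la = mu + unit_tuple i" for i
    by (auto simp: algebra_simps)
  have "(\<Sum>i\<in>down_rows N la. of_int (la i - int i + a) * bounded_schur N x 0 (la - unit_tuple i) mu) =
      (\<Sum>i\<in>{i \<in> {1..N}. la = mu + unit_tuple i}. of_int (la i - int i + a))"
    by (rule sum.mono_neutral_cong_right)
      (use mu in \<open>auto simp: bounded_schur_0 eq[symmetric] split: if_splits\<close>)
  also have "\<dots> = (\<Sum>i\<in>{i \<in> {1..N}. la = mu + unit_tuple i}. of_int (mu i - int i + 1 + a))"
    by (rule sum.cong) (auto simp: algebra_simps)
  also have "\<dots> = (\<Sum>i\<in>up_rows N mu. of_int (mu i - int i + 1 + a) *
      bounded_schur N x 0 la (mu + unit_tuple i))"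
    by (rule sum.mono_neutral_cong_left)
      (use la in \<open>auto simp: bounded_schur_0 split: if_splits\<close>)
  finally show ?thesis .
qed

section \<open>Induction on the number of variables\<close>

lemma subpartitions_partitions: "subpartitions N la \<subseteq> partitions N"
  by (auto simp: subpartitions_def)

lemma subpartitions_mono: "tuple_le N mu la \<Longrightarrow> subpartitions N mu \<subseteq> subpartitions N la"
  by (force simp: subpartitions_def tuple_le_def)

lemma tuple_le_diff_unit: "tuple_le N (la - unit_tuple i) la"
  by (auto simp: tuple_le_def unit_tuple_def)

text \<open>This is the cancellation of the middle terms. Renaming \<open>nu - unit_tuple i\<close>
  to \<open>nu\<close> increases the row length in the coefficient by one, which turns the scalar
  \<open>a - 1\<close> into \<open>a\<close>.\<close>

lemma sum_move_cell:
  fixes s :: "(nat \<Rightarrow> int) \<Rightarrow> 'a::comm_ring_1"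
  shows "(\<Sum>nu\<in>subpartitions N la. \<Sum>i\<in>down_rows N nu.
        of_int (nu i - int i + (a - 1)) * s (nu - unit_tuple i) * strip_weight N y la nu) =
    (\<Sum>nu\<in>subpartitions N la. \<Sum>i\<in>up_rows N nu.
        of_int (nu i - int i + a) * s nu * strip_weight N y la (nu + unit_tuple i))"
proof -
  let ?F = "subpartitions N la"
  let ?A = "SIGMA nu:?F. down_rows N nu" and ?B = "SIGMA nu:?F. up_rows N nu"
  \<comment> \<open>Pairs whose raised shape is no longer inside \<open>la\<close> are not reached
    by the renaming; their strip weight is 0.\<close>
  let ?Out = "{z \<in> ?B. fst z + unit_tuple (snd z) \<notin> ?F}"
  have fin: "finite ?Out" using finite_subpartitions[of N la] by (intro finite_Collect_conjI disjI1) auto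
  have down: "nu - unit_tuple i \<in> ?F" if "nu \<in> ?F" "nu - unit_tuple i \<in> partitions N" for nu i
    using that by (force simp: subpartitions_def tuple_le_def unit_tuple_def)
  have "(\<Sum>(nu, i)\<in>?A. of_int (nu i - int i + (a - 1)) * s (nu - unit_tuple i) * strip_weight N y la nu) =
      (\<Sum>(nu, i)\<in>?B. of_int (nu i - int i + a) * s nu * strip_weight N y la (nu + unit_tuple i))"
  proof (rule sum.reindex_bij_witness_not_neutral[where S' = "{}" and T' = ?Out and
        i = "\<lambda>(nu, i). (nu + unit_tuple i, i)" and j = "\<lambda>(nu, i). (nu - unit_tuple i, i)"],
      goal_cases)
    case 2
    then show ?case by (rule fin)
  next
    case (4 w)
    then show ?case using subpartitions_partitions[of N la] by (auto simp: down)
  next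
    case (6 w)
    then show ?case by (auto simp: subpartitions_def)
  next
    case (8 w)
    then show ?case
      by (auto simp: strip_weight_def horizontal_strip_def subpartitions_def)
  qed (auto simp: algebra_simps)
  then show ?thesis
    using finite_subpartitions[of N la] by (subst (1 2) sum.Sigma) auto
qed

text \<open>Each variable lowers the scalar on the right by one, so the induction must leave
  \<open>a\<close> arbitrary. The \<open>1\<close> in the second coefficient appears because that
  coefficient is read off from row \<open>i\<close> of the larger shape
  \<open>mu + unit_tuple i\<close>.\<close>

lemma (in unit_derivation) bounded_schur:
  assumes x: "\<And>i. i \<in> {1..n} \<Longrightarrow> D (x i) = 1"
    and la: "la \<in> partitions N" and mu: "mu \<in> partitions N"
  shows "D (bounded_schur N x n la mu) =
    (\<Sum>i\<in>down_rows N la. of_int (la i - int i + a) * bounded_schur N x n (la - unit_tuple i) mu) -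
    (\<Sum>i\<in>up_rows N mu. of_int (mu i - int i + 1 + a - int n) * bounded_schur N x n la (mu + unit_tuple i))"
  using x la mu
proof (induction n arbitrary: la mu a)
  case 0
  have "D (bounded_schur N x 0 la mu) = 0"
    using 0 by (simp add: bounded_schur_0 zero one)
  then show ?case using bounded_schur_0_cancel[OF 0(2,3), of a x] by (simp only: of_nat_0 diff_0_right diff_self)
next
  case (Suc n)
  note la = Suc.prems(2) and mu = Suc.prems(3)
  let ?F = "subpartitions N la" and ?H = "strip_weight N (x (Suc n))"
  let ?S = "bounded_schur N x n"
  note br = bounded_schur_branching[OF _ _ finite_subpartitions, where x = x and n = n]
  \<comment> \<open>The induction hypothesis is taken at \<open>a - 1\<close>, the scalar that the
    one-variable identity at \<open>a\<close> produces on its right side; this makes the middle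
    terms agree.\<close>
  have hyp: "D (?S nu mu) =
      (\<Sum>i\<in>down_rows N nu. of_int (nu i - int i + (a - 1)) * ?S (nu - unit_tuple i) mu) -
      (\<Sum>i\<in>up_rows N mu. of_int (mu i - int i + 1 + (a - 1) - int n) * ?S nu (mu + unit_tuple i))"
    if "nu \<in> ?F" for nu
    using that by (intro Suc.IH) (use Suc.prems in \<open>auto simp: subpartitions_def\<close>)
  have one_var: "D (?H la nu) =
      (\<Sum>i\<in>down_rows N la. of_int (la i - int i + a) * ?H (la - unit_tuple i) nu) -
      (\<Sum>i\<in>up_rows N nu. of_int (nu i - int i + a) * ?H la (nu + unit_tuple i))"
    if "nu \<in> ?F" for nu
    using that by (intro strip_weight) (use Suc.prems in \<open>auto simp: subpartitions_def\<close>)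
  have "D (bounded_schur N x (Suc n) la mu) =
      (\<Sum>nu\<in>?F. D (?S nu mu) * ?H la nu + ?S nu mu * D (?H la nu))"
    by (simp add: br[OF la mu order_refl subpartitions_partitions] sum mult)
  then have "D (bounded_schur N x (Suc n) la mu) =
      (\<Sum>nu\<in>?F. \<Sum>i\<in>down_rows N nu.
         of_int (nu i - int i + (a - 1)) * ?S (nu - unit_tuple i) mu * ?H la nu) -
      (\<Sum>nu\<in>?F. \<Sum>i\<in>up_rows N mu.
         of_int (mu i - int i + 1 + (a - 1) - int n) * ?S nu (mu + unit_tuple i) * ?H la nu) +
      (\<Sum>nu\<in>?F. \<Sum>i\<in>down_rows N la.
         ?S nu mu * (of_int (la i - int i + a) * ?H (la - unit_tuple i) nu)) -
      (\<Sum>nu\<in>?F. \<Sum>i\<in>up_rows N nu.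
         ?S nu mu * (of_int (nu i - int i + a) * ?H la (nu + unit_tuple i)))"
    by (simp add: hyp one_var left_diff_distrib right_diff_distrib sum_distrib_right sum_distrib_left
        sum_subtractf sum.distrib del: of_int_add of_int_diff)
  moreover have "(\<Sum>nu\<in>?F. \<Sum>i\<in>up_rows N mu.
         of_int (mu i - int i + 1 + (a - 1) - int n) * ?S nu (mu + unit_tuple i) * ?H la nu) =
      (\<Sum>i\<in>up_rows N mu. of_int (mu i - int i + 1 + a - int (Suc n)) *
         bounded_schur N x (Suc n) la (mu + unit_tuple i))"
    by (subst sum.swap, rule sum.cong)
      (auto simp: br[OF la _ order_refl subpartitions_partitions] sum_distrib_left algebra_simps)
  moreover have "(\<Sum>nu\<in>?F. \<Sum>i\<in>down_rows N la.
         ?S nu mu * (of_int (la i - int i + a) * ?H (la - unit_tuple i) nu)) =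
      (\<Sum>i\<in>down_rows N la. of_int (la i - int i + a) *
         bounded_schur N x (Suc n) (la - unit_tuple i) mu)"
  proof (subst sum.swap, rule sum.cong)
    fix i assume i: "i \<in> down_rows N la"
    have "bounded_schur N x (Suc n) (la - unit_tuple i) mu =
        (\<Sum>nu\<in>?F. ?S nu mu * ?H (la - unit_tuple i) nu)"
      using i by (intro br[OF _ mu subpartitions_mono[OF tuple_le_diff_unit] subpartitions_partitions]) auto
    then show "(\<Sum>nu\<in>?F. ?S nu mu * (of_int (la i - int i + a) * ?H (la - unit_tuple i) nu)) =
        of_int (la i - int i + a) * bounded_schur N x (Suc n) (la - unit_tuple i) mu"
      by (simp add: sum_distrib_left mult.left_commute del: of_int_add of_int_diff)
  qed simp
  moreover have "(\<Sum>nu\<in>?F. \<Sum>i\<in>up_rows N nu.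
         ?S nu mu * (of_int (nu i - int i + a) * ?H la (nu + unit_tuple i))) =
      (\<Sum>nu\<in>?F. \<Sum>i\<in>down_rows N nu.
         of_int (nu i - int i + (a - 1)) * ?S (nu - unit_tuple i) mu * ?H la nu)"
    unfolding sum_move_cell[where s = "\<lambda>nu. ?S nu mu" and y = "x (Suc n)"]
    by (simp only: mult_ac)
  \<comment> \<open>Here \<open>p\<close> is the middle term, in which a cell of the intermediate
    shape moves.\<close>
  moreover have "p - q + r - p = r - q" for p q r :: 'a by simp
  ultimately show ?case by (simp only:)
qed

section \<open>The operator \<open>nabla\<close> is a derivation sending each variable to 1\<close>

lemma partial_deriv_superset:
  assumes "finite A" "Poly_Mapping.keys p \<subseteq> A"
  shows "partial_deriv i p =
    (\<Sum>m\<in>A. Poly_Mapping.single (m - Poly_Mapping.single i 1)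
      (int (Poly_Mapping.lookup m i) * Poly_Mapping.lookup p m))"
  unfolding partial_deriv_def
  by (rule sum.mono_neutral_left) (use assms in \<open>auto simp: in_keys_iff\<close>)

lemma partial_deriv_add: "partial_deriv i (p + q) = partial_deriv i p + partial_deriv i q"
proof -
  \<comment> \<open>Coefficients may cancel in \<open>p + q\<close>, so all three derivatives are
    summed over this common set.\<close>
  let ?A = "Poly_Mapping.keys p \<union> Poly_Mapping.keys q"
  show ?thesis
    using keys_add[of p q]
    by (simp add: partial_deriv_superset[of ?A] lookup_add distrib_left single_add sum.distrib)
qed

lemma partial_deriv_single:
  "partial_deriv i (Poly_Mapping.single m c) =
     Poly_Mapping.single (m - Poly_Mapping.single i 1) (int (Poly_Mapping.lookup m i) * c)"
  by (subst partial_deriv_superset[of "{m}"]) auto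

lemma partial_deriv_mult_single:
  "partial_deriv i (Poly_Mapping.single m c * Poly_Mapping.single m' c') =
     partial_deriv i (Poly_Mapping.single m c) * Poly_Mapping.single m' c' +
     Poly_Mapping.single m c * partial_deriv i (Poly_Mapping.single m' c')"
proof -
  let ?e = "Poly_Mapping.single i (1::nat)"
  \<comment> \<open>Exponent subtraction truncates, so it commutes with adding \<open>m'\<close>
    only if the variable \<open>i\<close> occurs in \<open>m\<close>. If it does not, the
    coefficient is 0 and both monomials in \<open>monomials\<close> vanish.\<close>
  have shift: "m - ?e + m' = m + m' - ?e" if "Poly_Mapping.lookup m i \<noteq> 0" for m m' :: "nat \<Rightarrow>\<^sub>0 nat"
    by (rule poly_mapping_eqI) (use that in \<open>auto simp: lookup_add lookup_minus lookup_single when_def\<close>)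
  have monomials: "Poly_Mapping.single (m - ?e + m') (int (Poly_Mapping.lookup m i) * c) =
      Poly_Mapping.single (m + m' - ?e) (int (Poly_Mapping.lookup m i) * c)"
    for m m' :: "nat \<Rightarrow>\<^sub>0 nat" and c
    by (cases "Poly_Mapping.lookup m i = 0") (simp, simp only: shift not_False_eq_True)
  show ?thesis
    using monomials[of m m' "c * c'"] monomials[of m' m "c * c'"]
    by (simp add: partial_deriv_single mult_single single_add[symmetric] lookup_add algebra_simps)
qed

text \<open>Every polynomial is a finite sum of monomials. Applied to each factor in turn, this
  reduces the Leibniz rule, whose two sides are biadditive, to a product of two monomials.\<close>

lemma mpoly_induct:
  fixes p :: mpoly_int
  assumes "\<And>m c. P (Poly_Mapping.single m c)" and "\<And>p q. P p \<Longrightarrow> P q \<Longrightarrow> P (p + q)"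
  shows "P p"
proof -
  have z: "P 0" using assms(1)[of 0 0] by simp
  have "P (sum f A)" if "\<And>i. P (f i)" for f :: "(nat \<Rightarrow>\<^sub>0 nat) \<Rightarrow> mpoly_int" and A
    by (induction A rule: infinite_finite_induct) (use z assms(2) that in auto)
  moreover have "p = (\<Sum>m\<in>Poly_Mapping.keys p. Poly_Mapping.single m (Poly_Mapping.lookup p m))"
    by (rule poly_mapping_eqI)
      (auto simp: lookup_sum lookup_single when_def in_keys_iff sum.delta')
  ultimately show ?thesis using assms(1) by metis
qed

lemma partial_deriv_mult: "partial_deriv i (p * q) = partial_deriv i p * q + p * partial_deriv i q"
proof (induction p rule: mpoly_induct)
  case (1 m c)
  show ?case
    by (induction q rule: mpoly_induct)
      (simp_all add: partial_deriv_mult_single partial_deriv_add distrib_left)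
qed (simp add: partial_deriv_add distrib_right)

lemma partial_deriv_X: "partial_deriv i (X j) = (if i = j then 1 else 0)"
  by (auto simp: X_def partial_deriv_single lookup_single)

interpretation nabla: unit_derivation "nabla N" for N
  by unfold_locales
    (simp_all add: nabla_def partial_deriv_add partial_deriv_mult sum.distrib sum_distrib_left
      sum_distrib_right)

lemma nabla_X: "i \<in> {1..N} \<Longrightarrow> nabla N (X i) = 1"
  by (simp add: nabla_def partial_deriv_X)

theorem theorem1:
  fixes N :: nat and a b :: int and la mu l m :: "nat \<Rightarrow> int"
  assumes "a + b = int N - 1"
    and "la \<in> partitions N" and "mu \<in> partitions N"
    and "\<And>i. i \<in> {1..N} \<Longrightarrow> l i = la i - int i"
    and "\<And>i. i \<in> {1..N} \<Longrightarrow> m i = mu i - int i"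
  shows "nabla N (skew_schur N la mu) =
    (\<Sum>i\<in>{i \<in> {1..N}. la - unit_tuple i \<in> partitions N}.
        of_int (l i + a) * skew_schur N (la - unit_tuple i) mu) +
    (\<Sum>i\<in>{i \<in> {1..N}. mu + unit_tuple i \<in> partitions N}.
        of_int (b - m i) * skew_schur N la (mu + unit_tuple i))"
proof -
  have "nabla N (skew_schur N la mu) =
    (\<Sum>i\<in>down_rows N la. of_int (la i - int i + a) * skew_schur N (la - unit_tuple i) mu) -
    (\<Sum>i\<in>up_rows N mu. of_int (mu i - int i + 1 + a - int N) * skew_schur N la (mu + unit_tuple i))"
    unfolding skew_schur_eq_bounded using assms(2,3) nabla_X by (intro nabla.bounded_schur) auto
  also have "(\<Sum>i\<in>down_rows N la. of_int (la i - int i + a) * skew_schur N (la - unit_tuple i) mu) =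
      (\<Sum>i\<in>down_rows N la. of_int (l i + a) * skew_schur N (la - unit_tuple i) mu)"
    by (rule sum.cong) (auto simp: assms(4))
  also have "(\<Sum>i\<in>up_rows N mu. of_int (mu i - int i + 1 + a - int N) * skew_schur N la (mu + unit_tuple i)) =
      - (\<Sum>i\<in>up_rows N mu. of_int (b - m i) * skew_schur N la (mu + unit_tuple i))"
    unfolding sum_negf[symmetric]
  proof (rule sum.cong)
    fix i assume "i \<in> up_rows N mu"
    \<comment> \<open>The hypothesis on \<open>a\<close> and \<open>b\<close> says
      \<open>1 + a - N = -b\<close>; this is where the sign of the second sum changes.\<close>
    then have "mu i - int i + 1 + a - int N = - (b - m i)" using assms(1,5) by simp
    then show "of_int (mu i - int i + 1 + a - int N) * skew_schur N la (mu + unit_tuple i) =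
        - (of_int (b - m i) * skew_schur N la (mu + unit_tuple i))"
      by (metis of_int_minus mult_minus_left)
  qed simp
  finally show ?thesis by (simp only: diff_minus_eq_add)
qed

end
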